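(* Let $a<b$ and let $p,s,q:[a,b]\to\mathbb{R}$ be continuous with $p>0$ on $[a,b]$. Then for any $x_0\in[a,b]$ and any initial value $\theta_0\in\mathbb{R}$, the initial value problem $$\theta'(x)=-\frac{\cos^2\theta(x)}{p(x)}-2s(x)\sin\theta(x)\cos\theta(x)+q(x)\sin^2\theta(x),\qquad \theta(x_0)=\theta_0,$$ has a unique solution $\theta$ defined on all of $[a,b]$.
   Context: A solution is a real-valued differentiable function on $[a,b]$ (one-sided derivatives at the endpoints) satisfying the equation at every point of $[a,b]$. *)

theory Defs
  imports "HOL-Analysis.Analysis"
begin

definition pruefer_rhs ::
    "(real \<Rightarrow> real) \<Rightarrow> (real \<Rightarrow> real) \<Rightarrow> (real \<Rightarrow> real) \<Rightarrow> real \<Rightarrow> real \<Rightarrow> real" where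
  "pruefer_rhs p s q x y =
     - ((cos y)\<^sup>2 / p x) - 2 * s x * sin y * cos y + q x * (sin y)\<^sup>2"

(* The derivative is taken within the interval, so it is one-sided at a and at b;
   the values of u outside {a..b} play no role. *)
definition ivp_solution ::
    "real \<Rightarrow> real \<Rightarrow> (real \<Rightarrow> real \<Rightarrow> real) \<Rightarrow> real \<Rightarrow> real \<Rightarrow> (real \<Rightarrow> real) \<Rightarrow> bool" where
  "ivp_solution a b F x\<^sub>0 y\<^sub>0 u \<longleftrightarrow>
     (\<forall>x\<in>{a..b}. (u has_real_derivative F x (u x)) (at x within {a..b})) \<and> u x\<^sub>0 = y\<^sub>0"

end

theory Submission
  imports Defs
begin

text \<open>
  The right-hand side is a trigonometric polynomial in \<open>\<theta>\<close> whose coefficients are continuous, hence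
  bounded, on the compact interval. At each \<open>x\<close> it is Lipschitz in \<open>\<theta>\<close> over the whole real line with
  a constant given by the coefficients (\<open>pruefer_rhs_lipschitz\<close>), hence with one constant \<open>L\<close> for all
  \<open>x\<close> in the interval. Such a global Lipschitz bound rules out blow-up, and the solution exists
  on the entire interval rather than only near \<open>x\<^sub>0\<close> (\<open>ivp_solution_global_unique\<close>).

  The solutions are the fixed points of the Picard operator
  \<open>(T u) x = y\<^sub>0 + (\<integral> t from x\<^sub>0 to x. F t (u t))\<close>. In the plain supremum norm \<open>T\<close> need not contract
  unless the interval is short. It is a contraction on the whole interval in Bielecki's norm
  \<open>sup \<bar>u x\<bar> / exp (c * \<bar>x - x\<^sub>0\<bar>)\<close> with \<open>c > L\<close>, because integrating the exponential weight away from
  \<open>x\<^sub>0\<close> gains a factor \<open>1 / c\<close> (\<open>exp_weight_bound\<close>), while the Lipschitz condition costs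
  only \<open>L\<close>. One application of Banach's theorem then yields existence and uniqueness together, with no
  gluing of local solutions.
\<close>

text \<open>
  The weight \<open>exp (c * \<bar>t - x\<^sub>0\<bar>)\<close> grows in both directions away from \<open>x\<^sub>0\<close>, so on either side it is,
  up to sign, the derivative of \<open>1 / c\<close> times itself; the mean value inequality compares \<open>f\<close> with
  this antiderivative.
\<close>

lemma exp_weight_bound:
  fixes f f' :: "real \<Rightarrow> real"
  assumes c: "c > 0" and x0: "x\<^sub>0 \<in> {a..b}" and x: "x \<in> {a..b}"
    and deriv: "\<And>t. t \<in> {a..b} \<Longrightarrow> (f has_real_derivative f' t) (at t within {a..b})"
    and init: "f x\<^sub>0 = 0"
    and bound: "\<And>t. t \<in> {a..b} \<Longrightarrow> \<bar>f' t\<bar> \<le> K * exp (c * \<bar>t - x\<^sub>0\<bar>)"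
  shows "\<bar>f x\<bar> \<le> K / c * exp (c * \<bar>x - x\<^sub>0\<bar>)"
proof -
  have "0 \<le> K * exp (c * \<bar>x\<^sub>0 - x\<^sub>0\<bar>)"
    using bound[OF x0] by linarith
  then have K: "K / c \<ge> 0"
    using c by simp
  have inner: "(f has_vector_derivative f' t) (at t)" if "a < t" "t < b" for t
    using deriv[of t] at_within_Icc_at[OF that] that
    by (simp add: has_real_derivative_iff_has_vector_derivative)
  have cont: "continuous_on {a..b} f"
    using deriv by (rule DERIV_continuous_on)
  consider "x = x\<^sub>0" | "x\<^sub>0 < x" | "x < x\<^sub>0" by linarith
  then show ?thesis
  proof cases
    case 1
    then show ?thesis using K init by simp
  next
    case 2
    have "norm (f x - f x\<^sub>0) \<le> K / c * exp (c * (x - x\<^sub>0)) - K / c * exp (c * (x\<^sub>0 - x\<^sub>0))"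
    proof (rule differentiable_bound_general[OF 2, where f' = f' and \<phi>' = "\<lambda>t. K * exp (c * (t - x\<^sub>0))"])
      show "((\<lambda>t. K / c * exp (c * (t - x\<^sub>0))) has_vector_derivative K * exp (c * (t - x\<^sub>0))) (at t)" for t
        unfolding has_real_derivative_iff_has_vector_derivative[symmetric]
        using c by (auto intro!: derivative_eq_intros)
      show "norm (f' t) \<le> K * exp (c * (t - x\<^sub>0))" if "x\<^sub>0 < t" "t < x" for t
        using bound[of t] that x0 x by auto
    qed (use x0 x c in \<open>auto intro!: continuous_intros inner continuous_on_subset[OF cont]\<close>)
    then show ?thesis using init K 2 by simp
  next
    case 3
    have "norm (f x\<^sub>0 - f x) \<le> - (K / c * exp (c * (x\<^sub>0 - x\<^sub>0))) - - (K / c * exp (c * (x\<^sub>0 - x)))"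
    proof (rule differentiable_bound_general[OF 3, where f' = f' and \<phi>' = "\<lambda>t. K * exp (c * (x\<^sub>0 - t))"])
      show "((\<lambda>t. - (K / c * exp (c * (x\<^sub>0 - t)))) has_vector_derivative K * exp (c * (x\<^sub>0 - t))) (at t)" for t
        unfolding has_real_derivative_iff_has_vector_derivative[symmetric]
        using c by (auto intro!: derivative_eq_intros)
      show "norm (f' t) \<le> K * exp (c * (x\<^sub>0 - t))" if "x < t" "t < x\<^sub>0" for t
        using bound[of t] that x0 x by auto
    qed (use x0 x c in \<open>auto intro!: continuous_intros inner continuous_on_subset[OF cont]\<close>)
    then show ?thesis using init K 3 by simp
  qed
qed

text \<open>
  The Picard operator is conjugated by Bielecki's weight, so that the weighted norm becomes the
  supremum norm and Banach's theorem applies in the complete space of bounded continuous functions. The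
  elements of that space live on the whole line; the operator produces functions that are constant
  outside the interval, and only their values inside it enter the integral.
\<close>

theorem ivp_solution_global_unique:
  fixes F :: "real \<Rightarrow> real \<Rightarrow> real"
  assumes x0: "x\<^sub>0 \<in> {a..b}"
    and contF: "continuous_on ({a..b} \<times> UNIV) (\<lambda>(t, y). F t y)"
    and lip: "\<And>t. t \<in> {a..b} \<Longrightarrow> L-lipschitz_on UNIV (F t)"
  shows "\<exists>u. ivp_solution a b F x\<^sub>0 y\<^sub>0 u \<and>
    (\<forall>v. ivp_solution a b F x\<^sub>0 y\<^sub>0 v \<longrightarrow> (\<forall>x\<in>{a..b}. v x = u x))"
proof -
  have L: "L \<ge> 0" using lip[OF x0] by (rule lipschitz_on_nonneg)
  \<comment> \<open>Any exponent above \<open>L\<close> makes the operator a contraction; \<open>2 * L + 1\<close> also covers \<open>L = 0\<close>.\<close>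
  define c where "c = 2 * L + 1"
  have c: "c > 0" "L / c < 1" "L / c \<ge> 0" using L by (auto simp: c_def)
  define w where "w = (\<lambda>x. exp (c * \<bar>x - x\<^sub>0\<bar>))"
  have w: "w x > 0" for x by (simp add: w_def)
  have contw: "continuous_on X w" for X
    unfolding w_def by (intro continuous_intros)
  define T where "T = (\<lambda>u x. y\<^sub>0 + (integral {a..x} (\<lambda>t. F t (u t)) - integral {a..x\<^sub>0} (\<lambda>t. F t (u t))))"
  have T_init: "T u x\<^sub>0 = y\<^sub>0" for u by (simp add: T_def)
  have T_cong: "T u x = T v x" if "\<And>t. t \<in> {a..b} \<Longrightarrow> u t = v t" "x \<in> {a..b}" for u v x
  proof -
    have "integral {a..z} (\<lambda>t. F t (u t)) = integral {a..z} (\<lambda>t. F t (v t))" if "z \<le> b" for z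
      by (rule integral_cong) (use that \<open>\<And>t. t \<in> {a..b} \<Longrightarrow> u t = v t\<close> in auto)
    then show ?thesis using that x0 by (simp add: T_def)
  qed
  have contFu: "continuous_on {a..b} (\<lambda>t. F t (u t))" if "continuous_on {a..b} u" for u
  proof -
    have "continuous_on {a..b} (\<lambda>t. (t, u t))"
      by (intro continuous_intros that)
    from continuous_on_compose2[OF contF this] show ?thesis by auto
  qed
  have T_deriv: "(T u has_real_derivative F x (u x)) (at x within {a..b})"
    if "continuous_on {a..b} u" "x \<in> {a..b}" for u x
    unfolding T_def
    using DERIV_add[OF DERIV_const
        DERIV_diff[OF integral_has_real_derivative[OF contFu[OF that(1)] that(2)] DERIV_const]]
    by simp
  have T_cont: "continuous_on {a..b} (T u)" if "continuous_on {a..b} u" for u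
    by (rule DERIV_continuous_on) (rule T_deriv[OF that])
  have T_lip: "\<bar>T u x - T v x\<bar> \<le> L * D / c * w x"
    if u: "continuous_on {a..b} u" and v: "continuous_on {a..b} v" and x: "x \<in> {a..b}"
      and D: "\<And>t. t \<in> {a..b} \<Longrightarrow> \<bar>u t - v t\<bar> \<le> D * w t" for u v D x
    unfolding w_def
  proof (rule exp_weight_bound[OF c(1) x0 x])
    show "((\<lambda>x. T u x - T v x) has_real_derivative F t (u t) - F t (v t)) (at t within {a..b})"
      if "t \<in> {a..b}" for t
      by (intro DERIV_diff T_deriv u v that)
    show "\<bar>F t (u t) - F t (v t)\<bar> \<le> L * D * exp (c * \<bar>t - x\<^sub>0\<bar>)" if t: "t \<in> {a..b}" for t
    proof -
      have "\<bar>F t (u t) - F t (v t)\<bar> \<le> L * \<bar>u t - v t\<bar>"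
        using lipschitz_onD[OF lip[OF t], of "u t" "v t"] by (simp add: dist_real_def)
      also have "\<dots> \<le> L * (D * w t)" by (intro mult_left_mono D t L)
      finally show ?thesis by (simp add: w_def mult.assoc)
    qed
  qed (simp add: T_init)

  let ?N = "\<lambda>g x. T (\<lambda>t. w t * g t) x / w x"
  have ext: "\<exists>h :: real \<Rightarrow>\<^sub>C real. \<forall>x. h x = f (clamp a b x)" if "continuous_on {a..b} f" for f
    using continuous_on_cbox_bcontfunE[of a b f] that by (metis box_real(2))
  have clamp_in: "clamp a b x \<in> {a..b}" for x
    using clamp_in_interval[of a b x] x0 by simp
  have clamp_id: "clamp a b x = x" if "x \<in> {a..b}" for x
    using clamp_cancel_cbox[of x a b] that by simp
  have wg_cont: "continuous_on X (\<lambda>t. w t * apply_bcontfun g t)" for g X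
    by (intro continuous_intros contw) auto
  have "\<exists>h :: real \<Rightarrow>\<^sub>C real. \<forall>x. h x = ?N g (clamp a b x)" for g :: "real \<Rightarrow>\<^sub>C real"
    by (rule ext) (intro continuous_intros T_cont wg_cont contw, use w in \<open>simp add: less_imp_neq[symmetric]\<close>)
  then obtain S :: "(real \<Rightarrow>\<^sub>C real) \<Rightarrow> (real \<Rightarrow>\<^sub>C real)"
    where S: "\<And>g x. S g x = ?N g (clamp a b x)" by metis
  have "dist (S g) (S h) \<le> L / c * dist g h" for g h
  proof (rule dist_bound)
    fix x
    let ?z = "clamp a b x"
    have "\<bar>w t * g t - w t * h t\<bar> \<le> dist g h * w t" for t
    proof -
      have "\<bar>w t * g t - w t * h t\<bar> = w t * \<bar>g t - h t\<bar>"
        using w[of t] by (simp add: abs_mult flip: right_diff_distrib)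
      also have "\<dots> \<le> w t * dist g h"
        using dist_bounded[of g t h] w[of t] by (simp add: dist_real_def)
      finally show ?thesis by (simp add: mult.commute)
    qed
    then have "\<bar>T (\<lambda>t. w t * g t) ?z - T (\<lambda>t. w t * h t) ?z\<bar> \<le> L * dist g h / c * w ?z"
      by (intro T_lip wg_cont clamp_in)
    then show "dist (S g x) (S h x) \<le> L / c * dist g h"
      using w[of ?z] by (simp add: S dist_real_def pos_divide_le_eq flip: diff_divide_distrib)
  qed
  then have "\<exists>!g. S g = g"
    using banach_fix_type[of "L / c" S] c by blast
  then obtain g where fixed: "S g = g" and unique: "\<And>h. S h = h \<Longrightarrow> h = g" by blast
  define u where "u = (\<lambda>t. w t * apply_bcontfun g t)"
  have u_cont: "continuous_on {a..b} u" unfolding u_def by (rule wg_cont)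
  have Tu: "T u x = u x" if "x \<in> {a..b}" for x
    using S[of g x] w[of x] unfolding fixed clamp_id[OF that] by (simp add: u_def)
  have sol: "ivp_solution a b F x\<^sub>0 y\<^sub>0 u"
    unfolding ivp_solution_def
  proof (intro conjI ballI)
    show "u x\<^sub>0 = y\<^sub>0" using Tu[OF x0] T_init by simp
    show "(u has_real_derivative F x (u x)) (at x within {a..b})" if "x \<in> {a..b}" for x
      using T_deriv[OF u_cont that]
      by (rule has_field_derivative_transform_within[where d = 1]) (use that Tu in auto)
  qed
  moreover have "v x = u x" if v: "ivp_solution a b F x\<^sub>0 y\<^sub>0 v" and x: "x \<in> {a..b}" for v x
  proof -
    have v_deriv: "(v has_real_derivative F t (v t)) (at t within {a..b})" if "t \<in> {a..b}" for t
      using v that by (simp add: ivp_solution_def)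
    then have v_cont: "continuous_on {a..b} v" by (rule DERIV_continuous_on)
    have Tv: "T v t = v t" if t: "t \<in> {a..b}" for t
    proof -
      \<comment> \<open>Both sides are antiderivatives of the same function with value \<open>y\<^sub>0\<close> at \<open>x\<^sub>0\<close>.\<close>
      have "\<bar>T v t - v t\<bar> \<le> 0 / c * exp (c * \<bar>t - x\<^sub>0\<bar>)"
        by (rule exp_weight_bound[OF c(1) x0 t, where f = "\<lambda>t. T v t - v t" and f' = "\<lambda>_. 0"])
          (use v DERIV_diff[OF T_deriv[OF v_cont] v_deriv] in
            \<open>auto simp: T_init ivp_solution_def\<close>)
      then show ?thesis by simp
    qed
    have "continuous_on {a..b} (\<lambda>t. v t / w t)"
      by (intro continuous_intros v_cont contw) (use w in \<open>simp add: less_imp_neq[symmetric]\<close>)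
    from ext[OF this] obtain h :: "real \<Rightarrow>\<^sub>C real"
      where h: "\<And>t. h t = v (clamp a b t) / w (clamp a b t)" by blast
    have wh: "w t * h t = v t" if "t \<in> {a..b}" for t
      using w[of t] by (simp add: h clamp_id[OF that])
    have "S h = h"
    proof (rule bcontfun_eqI)
      fix t
      have "T (\<lambda>t. w t * h t) (clamp a b t) = v (clamp a b t)"
        using T_cong[OF wh clamp_in] Tv[OF clamp_in] by simp
      then show "S h t = h t" by (simp add: S h)
    qed
    then show ?thesis using unique[of h] wh[OF x] by (simp add: u_def)
  qed
  ultimately show ?thesis by blast
qed

text \<open>
  By the double-angle formulas the derivative in \<open>y\<close> is
  \<open>(1 / p x + q x) * sin (2 * y) - 2 * s x * cos (2 * y)\<close>; the constant bounds it termwise.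
\<close>

lemma pruefer_rhs_lipschitz:
  "(\<bar>1 / p x\<bar> + 2 * \<bar>s x\<bar> + \<bar>q x\<bar>)-lipschitz_on UNIV (pruefer_rhs p s q x)"
proof (rule lipschitz_onI)
  fix y z :: real
  define d where "d = (\<lambda>y. (1 / p x + q x) * sin (2 * y) - 2 * s x * cos (2 * y))"
  have deriv: "(pruefer_rhs p s q x has_real_derivative d y) (at y within UNIV)" for y
    unfolding pruefer_rhs_def d_def sin_double cos_double divide_inverse
    by (rule derivative_eq_intros refl | simp)+ (simp add: algebra_simps power2_eq_square)
  have bound: "norm (d y) \<le> \<bar>1 / p x\<bar> + 2 * \<bar>s x\<bar> + \<bar>q x\<bar>" for y
  proof -
    have "\<bar>d y\<bar> \<le> \<bar>1 / p x + q x\<bar> * \<bar>sin (2 * y)\<bar> + 2 * \<bar>s x\<bar> * \<bar>cos (2 * y)\<bar>"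
      using abs_triangle_ineq4[of "(1 / p x + q x) * sin (2 * y)" "2 * s x * cos (2 * y)"]
      by (simp add: d_def abs_mult)
    also have "\<dots> \<le> \<bar>1 / p x + q x\<bar> * 1 + 2 * \<bar>s x\<bar> * 1"
      by (intro add_mono mult_left_mono abs_sin_le_one abs_cos_le_one) auto
    also have "\<dots> \<le> \<bar>1 / p x\<bar> + 2 * \<bar>s x\<bar> + \<bar>q x\<bar>"
      using abs_triangle_ineq[of "1 / p x" "q x"] by simp
    finally show ?thesis by simp
  qed
  show "dist (pruefer_rhs p s q x y) (pruefer_rhs p s q x z)
      \<le> (\<bar>1 / p x\<bar> + 2 * \<bar>s x\<bar> + \<bar>q x\<bar>) * dist y z"
    using field_differentiable_bound[OF convex_UNIV deriv bound] by (simp add: dist_norm)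
qed auto

theorem corollary2p3:
  fixes a b x\<^sub>0 \<theta>\<^sub>0 :: real and p s q :: "real \<Rightarrow> real"
  assumes "a < b"
    and "continuous_on {a..b} p"
    and "continuous_on {a..b} s"
    and "continuous_on {a..b} q"
    and "\<And>x. x \<in> {a..b} \<Longrightarrow> p x > 0"
    and "x\<^sub>0 \<in> {a..b}"
  shows "\<exists>\<theta>. ivp_solution a b (pruefer_rhs p s q) x\<^sub>0 \<theta>\<^sub>0 \<theta> \<and>
    (\<forall>\<phi>. ivp_solution a b (pruefer_rhs p s q) x\<^sub>0 \<theta>\<^sub>0 \<phi> \<longrightarrow> (\<forall>x\<in>{a..b}. \<phi> x = \<theta> x))"
proof -
  have p: "p x \<noteq> 0" if "x \<in> {a..b}" for x using assms(5)[OF that] by simp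
  let ?l = "\<lambda>x. \<bar>1 / p x\<bar> + 2 * \<bar>s x\<bar> + \<bar>q x\<bar>"
  have "continuous_on {a..b} ?l"
    by (intro continuous_intros assms) (use p in auto)
  then have "bounded (?l ` {a..b})"
    by (intro compact_imp_bounded compact_continuous_image) auto
  then obtain L where L: "\<And>x. x \<in> {a..b} \<Longrightarrow> ?l x \<le> L"
    unfolding bounded_iff by fastforce
  show ?thesis
  proof (rule ivp_solution_global_unique[OF assms(6)])
    have comp: "continuous_on ({a..b} \<times> UNIV) (\<lambda>z :: real \<times> real. f (fst z))"
      if "continuous_on {a..b} f" for f :: "real \<Rightarrow> real"
      by (rule continuous_on_compose2[OF that]) (auto intro: continuous_intros)
    show "continuous_on ({a..b} \<times> UNIV) (\<lambda>(x, y). pruefer_rhs p s q x y)"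
      unfolding pruefer_rhs_def case_prod_beta
      by (intro continuous_intros comp assms) (use p in auto)
    show "L-lipschitz_on UNIV (pruefer_rhs p s q x)" if "x \<in> {a..b}" for x
      using lipschitz_on_le[OF pruefer_rhs_lipschitz[of p x s q] L[OF that]] .
  qed
qed

end
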